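(* Let $b\ge2$ be an integer, $\mathcal{D}=\{0,1,\dots,b-1\}$, $E\subseteq\mathcal{D}$ nonempty, $A=\mathcal{D}\setminus E$, and let $F=\{(b-a)\bmod b: a\in E\}\subseteq\mathcal{D}$. For $d\in F$ and $m\ge1$ put $v_m(d)=\int_{[0,1)}(d-x)^m\,\mu_E(\mathrm{d}x)$. Then \[ K(b,E)=\frac{b}{\#E}\log(b)-\sum_{m=1}^\infty\frac{\zeta(m+1)\sum_{d\in F}v_m(d)}{b^{m+1}}. \]
   Context: $K(b,E)$ denotes the sum of $1/m$ over all positive integers $m$ none of whose base-$b$ digits lies in $E$ (zero if $E$ contains all positive digits). $\zeta$ is the Riemann zeta function. The measure $\mu_E$ on $[0,1)$: for every finite string $X=(d_l,\dots,d_1)$, $l\ge0$, with all $d_i\in A$ (including the empty string), put $n(X)=d_lb^{l-1}+\dots+d_1$ ($n(\text{empty})=0$); then $\mu_E=\sum_X b^{-l}\delta_{n(X)/b^l}$. It has total mass $b/\#E$. *)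

theory Defs
  imports "HOL-Analysis.Analysis"
begin

text \<open>The positions \<open>i\<close> with \<open>b ^ i \<le> m\<close> are exactly those of the base-\<open>b\<close> expansion of \<open>m > 0\<close>
  without leading zeros.\<close>

definition base_digits :: "nat \<Rightarrow> nat \<Rightarrow> nat set" where
  "base_digits b m = {m div b ^ i mod b | i. b ^ i \<le> m}"

definition admissible :: "nat \<Rightarrow> nat set \<Rightarrow> nat set" where
  "admissible b E = {m. m > 0 \<and> base_digits b m \<inter> E = {}}"

definition kempner_sum :: "nat \<Rightarrow> nat set \<Rightarrow> real" where
  "kempner_sum b E = (\<Sum>\<^sub>\<infinity>m\<in>admissible b E. 1 / real m)"

text \<open>The Dirichlet series of the Riemann zeta function; meaningful for \<open>s > 1\<close> only.\<close>

definition zeta :: "real \<Rightarrow> real" where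
  "zeta s = (\<Sum>n. 1 / real (Suc n) powr s)"

text \<open>Strings are lists \<open>[d\<^sub>l, \<dots>, d\<^sub>1]\<close> with the most significant digit first.\<close>

definition string_val :: "nat \<Rightarrow> nat list \<Rightarrow> nat" where
  "string_val b X = horner_sum id b (rev X)"

text \<open>The sum of the point masses \<open>b\<^sup>-\<^sup>l \<delta>\<^bsub>n(X)/b\<^sup>l\<^esub>\<close> over all strings \<open>X\<close> of length \<open>l \<ge> 0\<close>, as the
  image of the weighted counting measure on strings.\<close>

definition mu_E :: "nat \<Rightarrow> nat set \<Rightarrow> real measure" where
  "mu_E b E =
     distr (point_measure (lists ({..<b} - E)) (\<lambda>X. ennreal (1 / real b ^ length X)))
       (restrict_space borel {0..<1})
       (\<lambda>X. real (string_val b X) / real b ^ length X)"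

definition moment :: "nat \<Rightarrow> nat set \<Rightarrow> nat \<Rightarrow> nat \<Rightarrow> real" where
  "moment b E m d = (\<integral>x. (real d - x) ^ m \<partial>mu_E b E)"

end

theory Submission imports Defs begin

text \<open>
  Let \<open>W = b / card E\<close> be the mass of \<open>mu_E\<close> and let \<open>U n\<close> be the integral of \<open>1 / (n + x)\<close>. Splitting off
  the first digit of a string gives \<open>U n = 1 / n + (\<Sum>a\<in>A. U (n * b + a))\<close>, and the Kempner sum is the sum
  of \<open>U a\<close> over the nonzero digits \<open>a \<in> A\<close>. Summing the recursion over \<open>n < M\<close>, the values \<open>U n\<close> at those
  \<open>n\<close> whose last digit lies in \<open>E\<close> add up to the sum of \<open>U n\<close> over \<open>M \<le> n < M * b\<close>, which tends to
  \<open>W * ln b\<close>, plus a harmonic sum, minus the Kempner sum. On the other hand, expanding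
  \<open>1 / (k * b - d + x) - 1 / (k * b)\<close> into powers of \<open>(d - x) / (k * b)\<close> and summing over \<open>k\<close> turns the same
  quantity, with the harmonic sum removed, into the zeta series.
\<close>

section \<open>Interchanging the zeta and moment series\<close>

text \<open>Applied twice below to build a majorant in three variables. Nonnegativity reduces
  absolute summability on the product to iterated sums.\<close>

lemma summable_on_product_real:
  fixes f :: "'a \<Rightarrow> real" and g :: "'b \<Rightarrow> real"
  assumes "f summable_on A" "g summable_on B"
    and "\<And>x. x \<in> A \<Longrightarrow> f x \<ge> 0" "\<And>y. y \<in> B \<Longrightarrow> g y \<ge> 0"
  shows "(\<lambda>(x, y). f x * g y) summable_on A \<times> B"
proof (rule abs_summable_summable, subst Infinite_Sum.abs_summable_on_Sigma_iff, intro conjI ballI)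
  fix x assume x: "x \<in> A"
  have "(\<lambda>y. f x * g y) summable_on B"
    using assms(2) by (rule summable_on_cmult_right)
  then show "(\<lambda>y. norm (case (x, y) of (x, y) \<Rightarrow> f x * g y)) summable_on B"
    by (rule summable_on_cong[THEN iffD1, rotated]) (use assms x in auto)
next
  have "(\<lambda>x. f x * infsum g B) summable_on A"
    using assms(1) by (rule summable_on_cmult_left)
  moreover have "norm (infsum (\<lambda>y. norm (case (x, y) of (x, y) \<Rightarrow> f x * g y)) B) = f x * infsum g B"
    if "x \<in> A" for x
  proof -
    have "infsum (\<lambda>y. norm (case (x, y) of (x, y) \<Rightarrow> f x * g y)) B = infsum (\<lambda>y. f x * g y) B"
      by (rule infsum_cong) (use assms that in auto)
    also have "\<dots> = f x * infsum g B" by (rule infsum_cmult_right')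
    finally show ?thesis using assms that by (simp add: infsum_nonneg)
  qed
  ultimately show "(\<lambda>x. norm (infsum (\<lambda>y. norm (case (x, y) of (x, y) \<Rightarrow> f x * g y)) B)) summable_on A"
    by (simp cong: summable_on_cong)
qed

text \<open>The terms are nonnegative, so the ordered series is also an unordered sum, which can
  take part in rearrangements.\<close>

lemma zeta_has_sum:
  assumes "s > 1"
  shows "((\<lambda>k. 1 / real (Suc k) powr s) has_sum zeta s) UNIV"
proof -
  have "summable (\<lambda>k. 1 / real k powr s)"
    using assms summable_real_powr_iff[of "-s"] by (simp add: powr_minus_divide)
  then have "summable (\<lambda>k. 1 / real (Suc k) powr s)"
    using summable_Suc_iff[of "\<lambda>k. 1 / real k powr s"] by simp
  then show ?thesis
    unfolding zeta_def by (intro sums_nonneg_imp_has_sum summable_sums) auto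
qed

text \<open>Expanding \<open>zeta (m + 2)\<close> as a series over \<open>k\<close>, both sums are rearrangements of the absolutely
  convergent sum of \<open>w t * y t ^ (m + 1) / (k + 1) ^ (m + 2)\<close> over \<open>(m, k, t)\<close>.\<close>

lemma zeta_moment_series:
  fixes w y :: "'a \<Rightarrow> real"
  assumes w: "w summable_on T" "\<And>t. t \<in> T \<Longrightarrow> w t \<ge> 0"
    and y: "\<And>t. t \<in> T \<Longrightarrow> \<bar>y t\<bar> \<le> q" and q: "0 \<le> q" "q < 1"
  shows "\<exists>s. (\<lambda>m. zeta (real (Suc m + 1)) * (\<Sum>\<^sub>\<infinity>t\<in>T. w t * y t ^ Suc m)) sums s \<and>
    (\<lambda>k. \<Sum>\<^sub>\<infinity>t\<in>T. w t * (1 / (real (Suc k) - y t) - 1 / real (Suc k))) sums s"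
proof -
  define f where "f = (\<lambda>m k t. w t * y t ^ Suc m / real (Suc k) ^ (Suc m + 1))"
  have "(\<lambda>k. 1 / real (Suc k) powr 2) summable_on UNIV"
    using zeta_has_sum[of 2] by (auto simp: summable_on_def)
  moreover have "1 / real (Suc k) powr 2 = 1 / real (Suc k) ^ 2" for k
    by (simp add: powr_realpow flip: powr_numeral)
  ultimately have z2: "(\<lambda>k. 1 / real (Suc k) ^ 2) summable_on UNIV" by simp
  have g: "(\<lambda>m. q ^ Suc m) summable_on UNIV"
    using q by (intro summable_nonneg_imp_summable_on) (auto intro!: summable_mult summable_geometric)
  \<comment> \<open>The majorant: \<open>\<bar>y t\<bar> ^ (m + 1) \<le> q ^ (m + 1)\<close> and
    \<open>(k + 1) ^ (m + 2) \<ge> (k + 1) ^ 2\<close> separate the three variables.\<close>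
  have "(\<lambda>(m, p). q ^ Suc m * (case p of (k, t) \<Rightarrow> 1 / real (Suc k) ^ 2 * w t)) summable_on UNIV \<times> UNIV \<times> T"
    by (intro summable_on_product_real g z2 w) (use q w in auto)
  then have "(\<lambda>z. norm (case z of (m, k, t) \<Rightarrow> f m k t)) summable_on UNIV \<times> UNIV \<times> T"
  proof (rule Infinite_Sum.summable_on_comparison_test)
    fix z :: "nat \<times> nat \<times> 'a" assume "z \<in> UNIV \<times> UNIV \<times> T"
    then obtain m k t where z: "z = (m, k, t)" and t: "t \<in> T" by auto
    have "\<bar>y t ^ Suc m\<bar> \<le> q ^ Suc m"
      unfolding power_abs by (intro power_mono y t) auto
    moreover have "real (Suc k) ^ 2 \<le> real (Suc k) ^ (Suc m + 1)"
      by (intro power_increasing) auto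
    then have "1 / real (Suc k) ^ (Suc m + 1) \<le> 1 / real (Suc k) ^ 2"
      by (intro divide_left_mono mult_pos_pos) auto
    ultimately have "\<bar>y t ^ Suc m\<bar> * (1 / real (Suc k) ^ (Suc m + 1) * w t)
        \<le> q ^ Suc m * (1 / real (Suc k) ^ 2 * w t)"
      using w(2)[OF t] q by (intro mult_mono) auto
    then show "norm (case z of (m, k, t) \<Rightarrow> f m k t)
        \<le> (case z of (m, p) \<Rightarrow> q ^ Suc m * (case p of (k, t) \<Rightarrow> 1 / real (Suc k) ^ 2 * w t))"
      unfolding z f_def using w(2)[OF t] by (simp add: abs_mult mult_ac)
  qed auto
  then have fs: "(\<lambda>(m, k, t). f m k t) summable_on UNIV \<times> UNIV \<times> T"
    by (rule abs_summable_summable)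
  then obtain s where s: "((\<lambda>(m, k, t). f m k t) has_sum s) (UNIV \<times> UNIV \<times> T)"
    by (auto simp: summable_on_def)
  \<comment> \<open>The same sum with \<open>k\<close> outermost and \<open>m\<close> innermost, so
    that the geometric series in \<open>m\<close> can be summed first.\<close>
  have s': "((\<lambda>(k, t, m). f m k t) has_sum s) (UNIV \<times> T \<times> UNIV)"
    by (rule has_sum_reindex_bij_witness[where i = "\<lambda>(k, t, m). (m, k, t)" and j = "\<lambda>(m, k, t). (k, t, m)", THEN iffD1, OF _ _ _ _ _ _ s]) auto
  have "((\<lambda>m. zeta (real (Suc m + 1)) * (\<Sum>\<^sub>\<infinity>t\<in>T. w t * y t ^ Suc m)) has_sum s) UNIV"
  proof (rule has_sum_SigmaD[OF s])
    fix m :: nat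
    have sm: "(\<lambda>(k, t). f m k t) summable_on UNIV \<times> T"
      using summable_on_SigmaD1[of "\<lambda>m (k, t). f m k t" UNIV "\<lambda>_. UNIV \<times> T" m] fs by simp
    \<comment> \<open>At \<open>k = 0\<close> the denominator is 1, so this slice is the family
      \<open>w t * y t ^ Suc m\<close> itself.\<close>
    have "f m 0 summable_on T"
      using summable_on_SigmaD1[OF sm] by simp
    then have "((\<lambda>t. w t * y t ^ Suc m) has_sum (\<Sum>\<^sub>\<infinity>t\<in>T. w t * y t ^ Suc m)) T"
      by (intro has_sum_infsum) (simp add: f_def)
    from has_sum_cmult_right[OF this]
    have 1: "((\<lambda>t. f m k t) has_sum (1 / real (Suc k) ^ (Suc m + 1) * (\<Sum>\<^sub>\<infinity>t\<in>T. w t * y t ^ Suc m))) T" for k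
      by (rule has_sum_cong[THEN iffD1, rotated]) (simp add: f_def)
    have "real (Suc k) powr real (Suc m + 1) = real (Suc k) ^ (Suc m + 1)" for k
      by (rule powr_realpow) simp
    with zeta_has_sum[of "real (Suc m + 1)"]
    have 2: "((\<lambda>k. 1 / real (Suc k) ^ (Suc m + 1)) has_sum zeta (real (Suc m + 1))) UNIV"
      by simp
    show "((\<lambda>p. case (m, p) of (m, k, t) \<Rightarrow> f m k t) has_sum
        zeta (real (Suc m + 1)) * (\<Sum>\<^sub>\<infinity>t\<in>T. w t * y t ^ Suc m)) (UNIV \<times> T)"
      unfolding prod.case
      by (rule has_sum_SigmaI[OF _ has_sum_cmult_left[OF 2] sm]) (use 1 in simp)
  qed
  moreover have "((\<lambda>k. \<Sum>\<^sub>\<infinity>t\<in>T. w t * (1 / (real (Suc k) - y t) - 1 / real (Suc k))) has_sum s) UNIV"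
  proof (rule has_sum_SigmaD[OF s'])
    fix k :: nat
    define K where "K = real (Suc k)"
    have K: "K \<ge> 1" unfolding K_def by simp
    have sk: "(\<lambda>(t, m). f m k t) summable_on T \<times> UNIV"
      using summable_on_SigmaD1[of "\<lambda>k (t, m). f m k t" UNIV "\<lambda>_. T \<times> UNIV" k] s'
      by (auto simp: summable_on_def)
    have "((\<lambda>m. f m k t) has_sum w t * (1 / (K - y t) - 1 / K)) UNIV" if t: "t \<in> T" for t
    proof -
      have yK: "\<bar>y t / K\<bar> < 1" using y[OF t] q K by (simp add: abs_div)
      have "(\<lambda>m. (y t / K) ^ m) sums (1 / (1 - y t / K))"
        using yK by (intro geometric_sums) simp
      \<comment> \<open>The exponent of \<open>y t / K\<close> starts at 1 and one more
        \<open>K\<close> stands below, hence the factor \<open>y t / K^2\<close>. The sum is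
        \<open>y / (K * (K - y))\<close>, that is \<open>1 / (K - y) - 1 / K\<close>.\<close>
      then have "(\<lambda>m. w t * y t / K^2 * (y t / K) ^ m) sums (w t * y t / K^2 * (1 / (1 - y t / K)))"
        by (rule sums_mult)
      moreover have "w t * y t / K^2 * (y t / K) ^ m = f m k t" for m
        unfolding f_def K_def[symmetric] using K by (simp add: power_divide power2_eq_square)
      moreover have "w t * y t / K^2 * (1 / (1 - y t / K)) = w t * (1 / (K - y t) - 1 / K)"
      proof -
        have "K - y t > 0" using y[OF t] q K by linarith
        then show ?thesis using K by (simp add: divide_simps power2_eq_square)
      qed
      ultimately have "(\<lambda>m. f m k t) sums (w t * (1 / (K - y t) - 1 / K))" by simp
      moreover have "(\<lambda>m. f m k t) summable_on UNIV"
        using summable_on_SigmaD1[OF sk t] .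
      ultimately show ?thesis
        using has_sum_imp_sums has_sum_infsum sums_unique2 by metis
    qed
    then have "((\<lambda>t. w t * (1 / (K - y t) - 1 / K)) has_sum infsum (\<lambda>(t, m). f m k t) (T \<times> UNIV)) T"
      using has_sum_SigmaD[OF has_sum_infsum[OF sk]] by simp
    then have "infsum (\<lambda>(t, m). f m k t) (T \<times> UNIV) = (\<Sum>\<^sub>\<infinity>t\<in>T. w t * (1 / (K - y t) - 1 / K))"
      by (simp add: infsumI)
    then show "((\<lambda>p. case (k, p) of (k, t, m) \<Rightarrow> f m k t) has_sum
        (\<Sum>\<^sub>\<infinity>t\<in>T. w t * (1 / (real (Suc k) - y t) - 1 / real (Suc k)))) (T \<times> UNIV)"
      using has_sum_infsum[OF sk] by (simp add: K_def)
  qed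
  ultimately show ?thesis using has_sum_imp_sums by blast
qed

section \<open>Strings and admissible integers\<close>

lemma string_val_Nil [simp]: "string_val b [] = 0"
  by (simp add: string_val_def)

lemma string_val_snoc [simp]: "string_val b (X @ [d]) = d + b * string_val b X"
  by (simp add: string_val_def)

lemma string_val_Cons [simp]: "string_val b (a # X) = a * b ^ length X + string_val b X"
  by (simp add: string_val_def horner_sum_append mult.commute)

lemma string_val_less:
  assumes "X \<in> lists {..<b}"
  shows "string_val b X < b ^ length X"
  using assms
proof (induction X)
  case (Cons a X)
  have "a * b ^ length X + b ^ length X \<le> b * b ^ length X"
    using Cons.hyps mult_le_mono1[of "Suc a" b "b ^ length X"] by simp
  then show ?case using Cons.IH by simp
qed simp

lemma base_digits_small:
  assumes "0 < m" "m < b"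
  shows "base_digits b m = {m}"
proof -
  have "b ^ i \<le> m \<longleftrightarrow> i = 0" for i
  proof (cases i)
    case (Suc j)
    have "b \<le> b * b ^ j" using assms by simp
    then have "\<not> b * b ^ j \<le> m" using assms by linarith
    then show ?thesis using assms Suc by simp
  qed (use assms in simp)
  then show ?thesis using assms by (auto simp: base_digits_def)
qed

text \<open>Position 0 holds the last digit, and position \<open>i + 1\<close> of \<open>m\<close>
  is position \<open>i\<close> of \<open>m div b\<close>; the cutoff at the leading digit shifts
  along.\<close>

lemma base_digits_rec:
  assumes "b \<ge> 2" "m \<ge> b"
  shows "base_digits b m = insert (m mod b) (base_digits b (m div b))"
proof -
  have "(\<exists>i. d = m div b ^ i mod b \<and> b ^ i \<le> m) \<longleftrightarrow>
      d = m mod b \<or> (\<exists>i. d = m div b div b ^ i mod b \<and> b ^ i \<le> m div b)" for d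
  proof -
    have *: "b ^ i \<le> m div b \<longleftrightarrow> b ^ Suc i \<le> m" for i
      using assms by (simp add: less_eq_div_iff_mult_less_eq mult.commute)
    have "(\<exists>i. d = m div b ^ i mod b \<and> b ^ i \<le> m) \<longleftrightarrow>
       (d = m div b ^ 0 mod b \<and> b ^ 0 \<le> m) \<or> (\<exists>i. d = m div b ^ Suc i mod b \<and> b ^ Suc i \<le> m)"
      by (metis not0_implies_Suc)
    then show ?thesis using assms unfolding * by (simp add: div_mult2_eq)
  qed
  then show ?thesis by (auto simp: base_digits_def)
qed

lemma admissible_small:
  assumes "0 < m" "m < b"
  shows "m \<in> admissible b E \<longleftrightarrow> m \<notin> E"
  using assms by (simp add: admissible_def base_digits_small)

lemma admissible_rec:
  assumes "b \<ge> 2" "m \<ge> b"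
  shows "m \<in> admissible b E \<longleftrightarrow> m mod b \<notin> E \<and> m div b \<in> admissible b E"
  using assms by (auto simp: admissible_def base_digits_rec div_greater_zero_iff)

lemma string_val_pos:
  assumes "X \<noteq> []" "hd X \<noteq> 0" "b > 0"
  shows "string_val b X > 0"
  using assms by (cases X) auto

text \<open>A nonzero head rules out leading zeros, so these strings are the expansions of the
  admissible integers. Each direction strips or appends the last digit.\<close>

lemma bij_betw_string_val_admissible:
  assumes b: "b \<ge> 2"
  shows "bij_betw (string_val b) {X \<in> lists ({..<b} - E). X \<noteq> [] \<and> hd X \<noteq> 0} (admissible b E)"
proof (rule bij_betw_imageI)
  let ?S = "{X \<in> lists ({..<b} - E). X \<noteq> [] \<and> hd X \<noteq> 0}"
  show "inj_on (string_val b) ?S"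
  proof (rule inj_onI)
    fix X Y assume "X \<in> ?S" "Y \<in> ?S" "string_val b X = string_val b Y"
    then show "X = Y"
    proof (induction X arbitrary: Y rule: rev_induct)
      case (snoc d X)
      from snoc.prems obtain e Z where Y: "Y = Z @ [e]" by (cases Y rule: rev_cases) auto
      have de: "d < b" "e < b" and eq: "d + b * string_val b X = e + b * string_val b Z"
        using snoc.prems by (auto simp: Y)
      have "(d + b * string_val b X) mod b = (e + b * string_val b Z) mod b"
           "(d + b * string_val b X) div b = (e + b * string_val b Z) div b"
        using eq by simp_all
      then have *: "d = e" "string_val b X = string_val b Z" using de by simp_all
      \<comment> \<open>The induction hypothesis covers nonempty strings only. An empty remainder
        has value 0, a nonempty one has a nonzero head and thus positive value.\<close>
      have "X = [] \<longleftrightarrow> Z = []"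
        using snoc.prems *(2) string_val_pos[of X b] string_val_pos[of Z b] b
        by (auto simp: Y hd_append split: if_splits)
      then show ?case
        using snoc.IH[of Z] snoc.prems * by (cases "X = []") (auto simp: Y hd_append)
    qed simp
  qed
  have "string_val b X \<in> admissible b E" if "X \<in> ?S" for X
    using that
  proof (induction X rule: rev_induct)
    case (snoc d X)
    show ?case
    proof (cases "X = []")
      case True
      then show ?thesis using snoc.prems by (simp add: admissible_small)
    next
      case False
      then have X: "X \<in> ?S" using snoc.prems by (auto simp: hd_append)
      then have "string_val b X > 0" using string_val_pos[of X b] b by auto
      then have "b \<le> b * string_val b X" by simp
      then have "b \<le> string_val b (X @ [d])" by (simp add: trans_le_add2)
      then show ?thesis using snoc X b
        by (subst admissible_rec) auto
    qed
  qed simp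
  moreover have "m \<in> string_val b ` ?S" if "m \<in> admissible b E" for m
    using that
  proof (induction m rule: less_induct)
    case (less m)
    have m: "m > 0" using less.prems by (simp add: admissible_def)
    show ?case
    proof (cases "m < b")
      case True
      then have "[m] \<in> ?S" using less.prems m by (simp add: admissible_small)
      then show ?thesis by (rule rev_image_eqI) simp
    next
      case False
      then have *: "m mod b \<notin> E" "m div b \<in> admissible b E"
        using less.prems b admissible_rec[of b m E] by auto
      moreover have "m div b < m" using m b by simp
      ultimately obtain X where X: "X \<in> ?S" "m div b = string_val b X" using less.IH by blast
      then have "X @ [m mod b] \<in> ?S" using * b by (auto simp: hd_append)
      then show ?thesis by (rule rev_image_eqI) (simp flip: X(2))
    qed
  qed
  ultimately show "string_val b ` ?S = admissible b E" by blast
qed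

section \<open>Sums over strings and blocks\<close>

lemma lists_eq_insert_Nil_Cons: "lists A = insert [] (\<Union>a\<in>A. (#) a ` lists A)"
proof -
  have "X \<in> lists A \<longleftrightarrow> X \<in> insert [] (\<Union>a\<in>A. (#) a ` lists A)" for X
    by (cases X) auto
  then show ?thesis by blast
qed

text \<open>A nonempty string is determined by its first letter and its rest. This yields both the
  geometric sum over strings and the recursion of \<open>kempner_tail\<close>.\<close>

lemma infsum_lists_rec:
  fixes f :: "'a list \<Rightarrow> real"
  assumes "finite A" and f: "f summable_on lists A"
  shows "infsum f (lists A) = f [] + (\<Sum>a\<in>A. \<Sum>\<^sub>\<infinity>X\<in>lists A. f (a # X))"
proof (rule infsumI)
  have "(f has_sum (\<Sum>\<^sub>\<infinity>X\<in>lists A. f (a # X))) ((#) a ` lists A)" if "a \<in> A" for a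
  proof -
    have "f summable_on (#) a ` lists A"
      using f by (rule summable_on_subset) (use that in auto)
    then show ?thesis
      using infsum_reindex[of "(#) a" "lists A" f] has_sum_infsum by (fastforce simp: o_def)
  qed
  then have "(f has_sum (\<Sum>a\<in>A. \<Sum>\<^sub>\<infinity>X\<in>lists A. f (a # X))) (\<Union>a\<in>A. (#) a ` lists A)"
    using assms(1) by (intro sum_has_sum) auto
  then show "(f has_sum f [] + (\<Sum>a\<in>A. \<Sum>\<^sub>\<infinity>X\<in>lists A. f (a # X))) (lists A)"
    by (subst lists_eq_insert_Nil_Cons, intro has_sum_insert) auto
qed

text \<open>With \<open>N = card A * c\<close>, the sums over strings of length at most
  \<open>L\<close> satisfy \<open>S (L + 1) = 1 + N * S L\<close>. They stay below the fixed point
  \<open>1 / (1 - N)\<close>.\<close>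

lemma summable_on_lists_geometric:
  fixes c :: real
  assumes A: "finite A" and c: "c \<ge> 0" "real (card A) * c < 1"
  shows "(\<lambda>X. c ^ length X) summable_on lists A"
proof (rule nonneg_bdd_above_summable_on)
  let ?N = "real (card A) * c"
  define T where "T L = {X \<in> lists A. length X \<le> L}" for L
  have T: "finite (T L)" for L
    unfolding T_def using finite_lists_length_le[OF A, of L] by (auto simp: in_lists_conv_set subset_eq cong: conj_cong)
  have bound: "(\<Sum>X\<in>T L. c ^ length X) \<le> 1 / (1 - ?N)" for L
  proof (induction L)
    case 0
    have "T 0 = {[]}" by (auto simp: T_def)
    then show ?case using c by (simp add: field_simps)
  next
    case (Suc L)
    have "T (Suc L) = insert [] ((\<lambda>(a, X). a # X) ` (A \<times> T L))"
    proof -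
      have "X \<in> T (Suc L) \<longleftrightarrow> X \<in> insert [] ((\<lambda>(a, X). a # X) ` (A \<times> T L))" for X
        by (cases X) (auto simp: T_def)
      then show ?thesis by blast
    qed
    moreover have "inj_on (\<lambda>(a, X). a # X) (A \<times> T L)" by (auto simp: inj_on_def)
    ultimately have "(\<Sum>X\<in>T (Suc L). c ^ length X) = 1 + (\<Sum>(a, X)\<in>A \<times> T L. c * c ^ length X)"
      using A T by (auto simp: sum.insert_if sum.reindex case_prod_unfold)
    also have "\<dots> = 1 + ?N * (\<Sum>X\<in>T L. c ^ length X)"
      by (simp add: sum.cartesian_product[symmetric] sum_distrib_left[symmetric])
    also have "\<dots> \<le> 1 + ?N * (1 / (1 - ?N))"
      using Suc c by (intro add_left_mono mult_left_mono) auto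
    also have "\<dots> = 1 / (1 - ?N)" using c by (simp add: field_simps)
    finally show ?case .
  qed
  show "bdd_above (sum (\<lambda>X. c ^ length X) ` {F. F \<subseteq> lists A \<and> finite F})"
  proof (rule bdd_aboveI2)
    fix F assume F: "F \<in> {F. F \<subseteq> lists A \<and> finite F}"
    \<comment> \<open>For empty \<open>F\<close> the maximum is unspecified, but the inclusion is
      trivial.\<close>
    then have "F \<subseteq> T (Max (length ` F))" by (auto simp: T_def intro!: Max_ge)
    then have "(\<Sum>X\<in>F. c ^ length X) \<le> (\<Sum>X\<in>T (Max (length ` F)). c ^ length X)"
      using T c by (intro sum_mono2) auto
    also note bound
    finally show "(\<Sum>X\<in>F. c ^ length X) \<le> 1 / (1 - ?N)" .
  qed
qed (use c in auto)

text \<open>Once the sum exists, splitting off the first letter gives a linear equation for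
  it.\<close>

lemma infsum_lists_geometric:
  fixes c :: real
  assumes "finite A" "c \<ge> 0" "real (card A) * c < 1"
  shows "(\<Sum>\<^sub>\<infinity>X\<in>lists A. c ^ length X) = 1 / (1 - real (card A) * c)"
proof -
  let ?S = "\<Sum>\<^sub>\<infinity>X\<in>lists A. c ^ length X"
  have "?S = 1 + real (card A) * (c * ?S)"
    using infsum_lists_rec[OF assms(1) summable_on_lists_geometric[OF assms]]
    by (simp add: infsum_cmult_right')
  then show ?thesis using assms by (simp add: field_simps)
qed

section \<open>Harmonic sums and the limit \<open>ln b\<close>\<close>

lemma sum_inverse_Suc_eq_harm_diff:
  assumes "M \<le> N"
  shows "(\<Sum>n\<in>{M..<N}. 1 / (real n + 1)) = harm N - harm M"
proof -
  have "(\<Sum>n\<in>{M..<N}. 1 / (real n + 1)) = (\<Sum>n\<in>{M..<N}. harm (Suc n) - harm n)"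
    by (rule sum.cong) (simp_all add: harm_Suc inverse_eq_divide add.commute)
  then show ?thesis using assms by (simp add: sum_Suc_diff')
qed

lemma sum_inverse_le_harm_diff:
  assumes "1 \<le> M" "M \<le> N"
  shows "(\<Sum>n\<in>{M..<N}. 1 / real n) \<le> harm N - harm M + 1 / real M"
proof -
  \<comment> \<open>For positive \<open>n\<close>, \<open>harm n - 1 / n\<close> is the harmonic
    number of \<open>n - 1\<close>, so the sum telescopes.\<close>
  have "(\<Sum>n\<in>{M..<N}. 1 / real n) =
      (\<Sum>n\<in>{M..<N}. (harm (Suc n) - 1 / real (Suc n)) - (harm n - 1 / real n))"
    by (rule sum.cong) (simp_all add: harm_Suc inverse_eq_divide add.commute)
  also have "\<dots> = (harm N - 1 / real N) - (harm M - 1 / real M)"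
    using assms by (subst sum_Suc_diff') auto
  finally show ?thesis by simp
qed

text \<open>\<open>harm n - ln n\<close> tends to the Euler-Mascheroni constant along
  \<open>M * b\<close> and along \<open>M\<close>; the constant cancels and
  \<open>ln (M * b) - ln M = ln b\<close> remains.\<close>

lemma harm_mult_diff_LIMSEQ:
  assumes "b > 0"
  shows "(\<lambda>M. harm (M * b) - harm M) \<longlonglongrightarrow> ln (real b)"
proof -
  have "filterlim (\<lambda>M. M * b) at_top sequentially"
    using assms by (intro filterlim_subseq) (auto simp: strict_mono_def)
  then have "(\<lambda>M. (harm (M * b) - ln (real (M * b))) - (harm M - ln (real M)) + ln (real b))
      \<longlonglongrightarrow> euler_mascheroni - euler_mascheroni + ln (real b)"
    by (intro tendsto_intros euler_mascheroni_LIMSEQ filterlim_compose[OF euler_mascheroni_LIMSEQ])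
  moreover have "eventually (\<lambda>M. (harm (M * b) - ln (real (M * b))) - (harm M - ln (real M)) + ln (real b)
      = harm (M * b) - harm M) sequentially"
    using eventually_gt_at_top[of 0] by eventually_elim (use assms in \<open>simp add: ln_mult\<close>)
  ultimately show ?thesis using Lim_transform_eventually by fastforce
qed

text \<open>The upper and lower harmonic bounds differ by at most \<open>W / M\<close>, so both
  squeeze to the same limit.\<close>

lemma sum_reciprocal_like_LIMSEQ:
  fixes U :: "nat \<Rightarrow> real"
  assumes "b > 0" "W \<ge> 0"
    and U: "\<And>n. n > 0 \<Longrightarrow> W / (real n + 1) \<le> U n" "\<And>n. n > 0 \<Longrightarrow> U n \<le> W / real n"
  shows "(\<lambda>M. \<Sum>n\<in>{M..<M * b}. U n) \<longlonglongrightarrow> W * ln (real b)"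
proof (rule tendsto_sandwich)
  show "eventually (\<lambda>M. W * (harm (M * b) - harm M) \<le> (\<Sum>n\<in>{M..<M * b}. U n)) sequentially"
    using eventually_gt_at_top[of 0]
  proof eventually_elim
    case (elim M)
    have "W * (harm (M * b) - harm M) = (\<Sum>n\<in>{M..<M * b}. W / (real n + 1))"
      using sum_inverse_Suc_eq_harm_diff[of M "M * b", symmetric] assms(1) by (simp add: sum_distrib_left)
    also have "\<dots> \<le> (\<Sum>n\<in>{M..<M * b}. U n)"
      using elim by (intro sum_mono U) auto
    finally show ?case .
  qed
  show "eventually (\<lambda>M. (\<Sum>n\<in>{M..<M * b}. U n) \<le> W * (harm (M * b) - harm M + 1 / real M)) sequentially"
    using eventually_gt_at_top[of 0]
  proof eventually_elim
    case (elim M)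
    have "(\<Sum>n\<in>{M..<M * b}. U n) \<le> (\<Sum>n\<in>{M..<M * b}. W * (1 / real n))"
      using elim U(2) by (intro sum_mono) auto
    also have "\<dots> = W * (\<Sum>n\<in>{M..<M * b}. 1 / real n)" by (rule sum_distrib_left[symmetric])
    also have "\<dots> \<le> W * (harm (M * b) - harm M + 1 / real M)"
      using elim assms by (intro mult_left_mono sum_inverse_le_harm_diff) auto
    finally show ?case .
  qed
  show "(\<lambda>M. W * (harm (M * b) - harm M)) \<longlonglongrightarrow> W * ln (real b)"
    by (intro tendsto_intros harm_mult_diff_LIMSEQ assms)
  have "(\<lambda>M. W * (harm (M * b) - harm M + 1 / real M)) \<longlonglongrightarrow> W * (ln (real b) + 0)"
    by (intro tendsto_intros harm_mult_diff_LIMSEQ assms lim_1_over_n)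
  then show "(\<lambda>M. W * (harm (M * b) - harm M + 1 / real M)) \<longlonglongrightarrow> W * ln (real b)" by simp
qed

section \<open>Blocks of \<open>b\<close> consecutive integers and their excluded last
  digits\<close>

lemma sum_block_split_digits:
  fixes U :: "nat \<Rightarrow> real"
  assumes "E \<subseteq> {..<b}"
  shows "(\<Sum>n\<in>{k * b..<Suc k * b}. U n) = (\<Sum>a\<in>{..<b} - E. U (k * b + a)) + (\<Sum>a\<in>E. U (k * b + a))"
proof -
  have "(\<Sum>n\<in>{k * b..<Suc k * b}. U n) = (\<Sum>a<b. U (k * b + a))"
    using sum.shift_bounds_nat_ivl[of U 0 "k * b" b] by (simp add: add.commute atLeast0LessThan)
  also have "\<dots> = (\<Sum>a\<in>{..<b} - E. U (k * b + a)) + (\<Sum>a\<in>E. U (k * b + a))"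
    using assms by (intro sum.subset_diff) auto
  finally show ?thesis .
qed

lemma inj_on_negate_mod: "inj_on (\<lambda>a. (b - a) mod b) {..<b::nat}"
proof (rule inj_onI)
  fix x y assume "x \<in> {..<b}" "y \<in> {..<b}" "(b - x) mod b = (b - y) mod b"
  then show "x = y" by (cases "x = 0"; cases "y = 0") auto
qed

text \<open>The digit \<open>0\<close> negates to \<open>0\<close> and thus addresses the right end of the block rather than the left one.\<close>

lemma sum_negated_digits:
  fixes U :: "nat \<Rightarrow> real"
  assumes "E \<subseteq> {..<b}"
  shows "(\<Sum>d\<in>(\<lambda>a. (b - a) mod b) ` E. U (Suc k * b - d)) =
    (\<Sum>a\<in>E - {0}. U (k * b + a)) + (if 0 \<in> E then U (Suc k * b) else 0)"
proof -
  have fin: "finite E" using assms finite_subset by blast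
  have "inj_on (\<lambda>a. (b - a) mod b) E"
    using inj_on_negate_mod assms by (rule inj_on_subset)
  then have "(\<Sum>d\<in>(\<lambda>a. (b - a) mod b) ` E. U (Suc k * b - d)) = (\<Sum>a\<in>E. U (Suc k * b - (b - a) mod b))"
    by (simp add: sum.reindex)
  also have "\<dots> = (\<Sum>a\<in>E - {0}. U (Suc k * b - (b - a) mod b)) + (if 0 \<in> E then U (Suc k * b) else 0)"
    using fin sum.remove[of E 0 "\<lambda>a. U (Suc k * b - (b - a) mod b)"] by (cases "0 \<in> E") auto
  also have "(\<Sum>a\<in>E - {0}. U (Suc k * b - (b - a) mod b)) = (\<Sum>a\<in>E - {0}. U (k * b + a))"
  proof (rule sum.cong)
    fix a assume "a \<in> E - {0}"
    then have "0 < a" "a < b" using assms by auto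
    then show "U (Suc k * b - (b - a) mod b) = U (k * b + a)" by (simp add: add.commute)
  qed simp
  finally show ?thesis .
qed

text \<open>Passing from \<open>M\<close> to \<open>M + 1\<close> removes \<open>U M\<close> from
  the window and adds the block at \<open>M * b\<close>. By the recursion the allowed digits of that
  block contribute \<open>U M - 1 / M\<close>, so only \<open>- 1 / M\<close> and the excluded
  digits remain. The last term corrects for the digit 0 being counted at the right end of a
  block.\<close>

lemma sum_excluded_blocks:
  fixes U :: "nat \<Rightarrow> real"
  assumes E: "E \<subseteq> {..<b}" and b: "b \<ge> 2"
    and U: "\<And>n. n > 0 \<Longrightarrow> U n = 1 / real n + (\<Sum>a\<in>{..<b} - E. U (n * b + a))"
    and "M > 0"
  shows "(\<Sum>k<M. \<Sum>d\<in>(\<lambda>a. (b - a) mod b) ` E. U (Suc k * b - d)) =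
    (\<Sum>n\<in>{M..<M * b}. U n) - (\<Sum>a\<in>{..<b} - E - {0}. U a) + (\<Sum>n\<in>{1..<M}. 1 / real n)
      + (if 0 \<in> E then U (M * b) else 0)"
  using \<open>M > 0\<close>
proof (induction M rule: nat_induct_non_zero)
  case 1
  have "{..<b} - E - {0} \<union> (E - {0}) = {1..<b}" using E by auto
  then have "(\<Sum>n\<in>{1..<b}. U n) = (\<Sum>a\<in>{..<b} - E - {0}. U a) + (\<Sum>a\<in>E - {0}. U a)"
    using E by (subst sum.union_disjoint[symmetric]) (auto intro: finite_subset)
  then show ?case using sum_negated_digits[OF E, of U 0] by simp
next
  case (Suc M)
  have fin: "finite E" using E finite_subset by blast
  have E0: "(\<Sum>a\<in>E. U (M * b + a)) = (\<Sum>a\<in>E - {0}. U (M * b + a)) + (if 0 \<in> E then U (M * b) else 0)"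
    using fin sum.remove[of E 0 "\<lambda>a. U (M * b + a)"] by (cases "0 \<in> E") auto
  have "M * 2 \<le> M * b" using b by (intro mult_le_mono2)
  then have "M < Suc M * b" using Suc.hyps unfolding mult_Suc by linarith
  then have "(\<Sum>n\<in>{Suc M..<Suc M * b}. U n) = (\<Sum>n\<in>{M..<Suc M * b}. U n) - U M"
    using Suc.hyps by (subst sum.atLeast_Suc_lessThan[of M]) auto
  also have "(\<Sum>n\<in>{M..<Suc M * b}. U n) = (\<Sum>n\<in>{M..<M * b}. U n) + (\<Sum>n\<in>{M * b..<Suc M * b}. U n)"
    using b by (subst sum.atLeastLessThan_concat) auto
  also have "(\<Sum>n\<in>{M * b..<Suc M * b}. U n) = U M - 1 / real M + (\<Sum>a\<in>E. U (M * b + a))"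
    unfolding sum_block_split_digits[OF E] using U[OF Suc.hyps] by simp
  finally have "(\<Sum>n\<in>{Suc M..<Suc M * b}. U n) =
      (\<Sum>n\<in>{M..<M * b}. U n) - 1 / real M + (\<Sum>a\<in>E. U (M * b + a))" by simp
  moreover have "(\<Sum>n\<in>{1..<Suc M}. 1 / real n) = (\<Sum>n\<in>{1..<M}. 1 / real n) + 1 / real M"
    using Suc.hyps by simp
  ultimately show ?case
    using Suc.IH sum_negated_digits[OF E, of U M] E0 unfolding sum.lessThan_Suc by linarith
qed

section \<open>Tails of the Kempner sum\<close>

text \<open>The position of the atom that \<open>X\<close> contributes to
  \<open>mu_E\<close>.\<close>

definition string_frac :: "nat \<Rightarrow> nat list \<Rightarrow> real" where
  "string_frac b X = real (string_val b X) / real b ^ length X"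

text \<open>For \<open>n > 0\<close>, the sum of the reciprocals of all integers whose base-\<open>b\<close> expansion is that of \<open>n\<close>
  followed by a string over \<open>A\<close>; it equals the integral of \<open>1 / (n + x)\<close> against \<open>mu_E\<close>.\<close>

definition kempner_tail :: "nat \<Rightarrow> nat set \<Rightarrow> nat \<Rightarrow> real" where
  "kempner_tail b A n = (\<Sum>\<^sub>\<infinity>X\<in>lists A. 1 / real (n * b ^ length X + string_val b X))"

text \<open>\<open>A\<close> is the set of allowed digits. Properness of the inclusion says that
  some digit is excluded; it gives \<open>card A < b\<close>, which makes the total weight of all
  strings finite.\<close>

locale missing_digits =
  fixes b :: nat and A :: "nat set"
  assumes digits: "A \<subset> {..<b}"
begin

lemma b_pos: "b > 0"
  using digits by (cases b) auto

lemma finite_digits: "finite A"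
  using digits finite_subset by blast

lemma card_digits: "card A < b"
  using psubset_card_mono[OF _ digits] by simp

definition "mass = real b / (real b - real (card A))"

lemma mass_nonneg: "mass \<ge> 0"
  using card_digits by (simp add: mass_def)

lemma weight_has_sum: "((\<lambda>X. 1 / real b ^ length X) has_sum mass) (lists A)"
proof -
  have *: "real (card A) * (1 / real b) < 1" using card_digits b_pos by simp
  have "((\<lambda>X. (1 / real b) ^ length X) has_sum 1 / (1 - real (card A) * (1 / real b))) (lists A)"
    using summable_on_lists_geometric[OF finite_digits _ *] infsum_lists_geometric[OF finite_digits _ *]
      has_sum_infsum by fastforce
  moreover have "1 / (1 - real (card A) * (1 / real b)) = mass"
    using b_pos by (simp add: mass_def field_simps)
  ultimately show ?thesis by (simp add: power_divide)
qed

lemma string_frac_bounds: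
  assumes "X \<in> lists A"
  shows "0 \<le> string_frac b X" "string_frac b X < 1"
proof -
  have "string_val b X < b ^ length X"
    using assms digits by (intro string_val_less) auto
  then have "real (string_val b X) < real b ^ length X"
    by (metis of_nat_less_iff of_nat_power)
  then show "0 \<le> string_frac b X" "string_frac b X < 1"
    using b_pos by (simp_all add: string_frac_def)
qed

text \<open>Dividing by \<open>b ^ length X\<close> turns the reciprocal into the weight of an atom
  times \<open>1 / (n + x)\<close> at that atom. All estimates of \<open>kempner_tail\<close> go
  through this form.\<close>

lemma reciprocal_eq_weighted:
  "1 / real (n * b ^ length X + string_val b X) = 1 / real b ^ length X * (1 / (real n + string_frac b X))"
proof -
  have "real n + string_frac b X = real (n * b ^ length X + string_val b X) / real b ^ length X"
    using b_pos by (simp add: string_frac_def field_simps)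
  then show ?thesis using b_pos by simp
qed

lemma kempner_tail_has_sum:
  assumes "n > 0"
  shows "((\<lambda>X. 1 / real (n * b ^ length X + string_val b X)) has_sum kempner_tail b A n) (lists A)"
  unfolding kempner_tail_def
proof (rule has_sum_infsum, rule Infinite_Sum.summable_on_comparison_test)
  show "(\<lambda>X. 1 / real b ^ length X) summable_on lists A"
    using weight_has_sum by (auto simp: summable_on_def)
  fix X assume X: "X \<in> lists A"
  have "1 / real b ^ length X * (1 / (real n + string_frac b X)) \<le> 1 / real b ^ length X * 1"
    using string_frac_bounds[OF X] assms by (intro mult_left_mono) auto
  then show "1 / real (n * b ^ length X + string_val b X) \<le> 1 / real b ^ length X"
    unfolding reciprocal_eq_weighted by simp
qed simp

text \<open>Since \<open>0 \<le> x < 1\<close> at every atom, \<open>1 / (n + x)\<close> lies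
  between \<open>1 / (n + 1)\<close> and \<open>1 / n\<close>; summing against the weights gives the
  bounds.\<close>

lemma kempner_tail_bounds:
  assumes "n > 0"
  shows "mass / (real n + 1) \<le> kempner_tail b A n" "kempner_tail b A n \<le> mass / real n"
proof -
  have *: "1 / real b ^ length X * (1 / (real n + 1)) \<le> 1 / real (n * b ^ length X + string_val b X)"
    "1 / real (n * b ^ length X + string_val b X) \<le> 1 / real b ^ length X * (1 / real n)"
    if "X \<in> lists A" for X
    unfolding reciprocal_eq_weighted using string_frac_bounds[OF that] assms b_pos
    by (auto intro!: divide_left_mono mult_left_mono mult_pos_pos)
  show "mass / (real n + 1) \<le> kempner_tail b A n"
    using has_sum_mono[OF has_sum_cmult_left[OF weight_has_sum, of "1 / (real n + 1)"] kempner_tail_has_sum[OF assms] *(1)]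
    by simp
  show "kempner_tail b A n \<le> mass / real n"
    using has_sum_mono[OF kempner_tail_has_sum[OF assms] has_sum_cmult_left[OF weight_has_sum, of "1 / real n"] *(2)]
    by simp
qed

text \<open>Moving the first letter \<open>a\<close> of a string over to the prefix \<open>n\<close>
  produces the prefix \<open>n * b + a\<close>; the empty string gives \<open>1 / n\<close>.\<close>

lemma kempner_tail_rec:
  assumes "n > 0"
  shows "kempner_tail b A n = 1 / real n + (\<Sum>a\<in>A. kempner_tail b A (n * b + a))"
proof -
  have "(\<lambda>X. 1 / real (n * b ^ length X + string_val b X)) summable_on lists A"
    using kempner_tail_has_sum[OF assms] by (auto simp: summable_on_def)
  from infsum_lists_rec[OF finite_digits this] show ?thesis
    unfolding kempner_tail_def by (simp add: algebra_simps)
qed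

lemma kempner_tail_LIMSEQ_0:
  "(\<lambda>n. kempner_tail b A n) \<longlonglongrightarrow> 0"
proof (rule tendsto_sandwich)
  show "eventually (\<lambda>n. 0 \<le> kempner_tail b A n) sequentially"
    by (auto simp: kempner_tail_def intro!: always_eventually infsum_nonneg)
  show "eventually (\<lambda>n. kempner_tail b A n \<le> mass * (1 / real n)) sequentially"
    using eventually_gt_at_top[of 0] by eventually_elim (use kempner_tail_bounds(2) in simp)
  show "(\<lambda>n. mass * (1 / real n)) \<longlonglongrightarrow> 0"
    using tendsto_mult_left[OF lim_1_over_n, of mass] by simp
qed simp

text \<open>Admissible integers are grouped by their leading digit \<open>a\<close>, which is
  nonzero; each group sums to the tail at \<open>a\<close>.\<close>

lemma reciprocal_admissible_has_sum:
  assumes "b \<ge> 2" "A = {..<b} - E"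
  shows "((\<lambda>m. 1 / real m) has_sum (\<Sum>a\<in>A - {0}. kempner_tail b A a)) (admissible b E)"
proof -
  have "((\<lambda>X. 1 / real (string_val b X)) has_sum kempner_tail b A a) ((#) a ` lists A)"
    if "a \<in> A - {0}" for a
    using kempner_tail_has_sum[of a] that by (subst has_sum_reindex) (auto simp: o_def)
  then have "((\<lambda>X. 1 / real (string_val b X)) has_sum (\<Sum>a\<in>A - {0}. kempner_tail b A a))
      (\<Union>a\<in>A - {0}. (#) a ` lists A)"
    using finite_digits by (intro sum_has_sum) auto
  moreover have "(\<Union>a\<in>A - {0}. (#) a ` lists A) = {X \<in> lists A. X \<noteq> [] \<and> hd X \<noteq> 0}"
  proof -
    have "X \<in> (\<Union>a\<in>A - {0}. (#) a ` lists A) \<longleftrightarrow> X \<in> {X \<in> lists A. X \<noteq> [] \<and> hd X \<noteq> 0}" for X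
      by (cases X) auto
    then show ?thesis by blast
  qed
  ultimately show ?thesis
    using has_sum_reindex_bij_betw[OF bij_betw_string_val_admissible[OF assms(1), of E], of "\<lambda>m. 1 / real m"]
    by (simp add: assms(2))
qed

section \<open>Moments and the zeta series for a single digit\<close>

text \<open>\<open>mu_E\<close> is the image of a density over counting measure on strings, so its
  integrals are sums over strings. Absolute convergence follows from
  \<open>\<bar>d - x\<bar> \<le> d + 1\<close>.\<close>

lemma moment_eq_infsum:
  assumes "A = {..<b} - E"
  shows "moment b E m d = (\<Sum>\<^sub>\<infinity>X\<in>lists A. 1 / real b ^ length X * (real d - string_frac b X) ^ m)"
proof -
  let ?f = "\<lambda>X. 1 / real b ^ length X * (real d - string_frac b X) ^ m"
  have "moment b E m d = (\<integral>X. (real d - string_frac b X) ^ m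
      \<partial>point_measure (lists A) (\<lambda>X. ennreal (1 / real b ^ length X)))"
    unfolding moment_def mu_E_def assms[symmetric] string_frac_def[symmetric]
  proof (rule integral_distr)
    show "(\<lambda>X. string_frac b X) \<in> point_measure (lists A) (\<lambda>X. ennreal (1 / real b ^ length X))
        \<rightarrow>\<^sub>M restrict_space borel {0..<1}"
      using string_frac_bounds
      by (intro measurable_restrict_space2) (auto simp: space_point_measure)
  qed (intro measurable_restrict_space1, measurable)
  also have "\<dots> = (\<integral>X. ?f X \<partial>count_space (lists A))"
    unfolding point_measure_def by (subst integral_density) auto
  also have "\<dots> = infsetsum ?f (lists A)"
    by (simp add: infsetsum_def)
  also have "\<dots> = infsum ?f (lists A)"
  proof (rule infsetsum_infsum, subst abs_summable_equivalent[symmetric])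
    have "(\<lambda>X. 1 / real b ^ length X * (real d + 1) ^ m) summable_on lists A"
      using has_sum_cmult_left[OF weight_has_sum] by (auto simp: summable_on_def)
    then show "(\<lambda>X. norm (?f X)) summable_on lists A"
    proof (rule Infinite_Sum.summable_on_comparison_test)
      fix X assume X: "X \<in> lists A"
      have "\<bar>real d - string_frac b X\<bar> ^ m \<le> (real d + 1) ^ m"
        using string_frac_bounds[OF X] by (intro power_mono) auto
      then show "norm (?f X) \<le> 1 / real b ^ length X * (real d + 1) ^ m"
        by (simp add: abs_mult power_abs divide_right_mono)
    qed simp
  qed
  finally show ?thesis .
qed

text \<open>This is \<open>zeta_moment_series\<close> for \<open>y = (d - x) / b\<close>, divided by
  \<open>b\<close>: the term \<open>1 / (b * (k + 1 - y))\<close> equals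
  \<open>1 / ((k + 1) * b - d + x)\<close>.\<close>

lemma zeta_moment_sums_kempner_tail:
  assumes b: "b \<ge> 2" and A: "A = {..<b} - E" and d: "d < b"
  shows "\<exists>s. (\<lambda>m. zeta (real (Suc m + 1)) * moment b E (Suc m) d / real b ^ (Suc m + 1)) sums s \<and>
    (\<lambda>k. kempner_tail b A (Suc k * b - d) - mass / real (Suc k * b)) sums s"
proof -
  let ?w = "\<lambda>X. 1 / real b ^ length X" and ?y = "\<lambda>X. (real d - string_frac b X) / real b"
  have "\<bar>?y X\<bar> \<le> (real b - 1) / real b" if "X \<in> lists A" for X
  proof -
    \<comment> \<open>\<open>d - x\<close> is at most \<open>b - 1\<close> and exceeds -1, and
      \<open>b \<ge> 2\<close> makes -1 at least \<open>-(b - 1)\<close>.\<close>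
    have "\<bar>real d - string_frac b X\<bar> \<le> real b - 1"
      using string_frac_bounds[OF that] b d by linarith
    then show ?thesis using b_pos by (simp add: abs_div divide_right_mono)
  qed
  moreover have "?w summable_on lists A" using weight_has_sum by (auto simp: summable_on_def)
  ultimately obtain s where
    s1: "(\<lambda>m. zeta (real (Suc m + 1)) * (\<Sum>\<^sub>\<infinity>X\<in>lists A. ?w X * ?y X ^ Suc m)) sums s" and
    s2: "(\<lambda>k. \<Sum>\<^sub>\<infinity>X\<in>lists A. ?w X * (1 / (real (Suc k) - ?y X) - 1 / real (Suc k))) sums s"
    using zeta_moment_series[of ?w "lists A" ?y "(real b - 1) / real b"] b by auto
  have "(\<Sum>\<^sub>\<infinity>X\<in>lists A. ?w X * ?y X ^ Suc m) = moment b E (Suc m) d / real b ^ Suc m" for m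
  proof -
    have "(\<Sum>\<^sub>\<infinity>X\<in>lists A. ?w X * ?y X ^ Suc m) =
        (\<Sum>\<^sub>\<infinity>X\<in>lists A. ?w X * (real d - string_frac b X) ^ Suc m * (1 / real b ^ Suc m))"
      by (rule infsum_cong) (simp add: power_divide)
    then show ?thesis unfolding infsum_cmult_left' moment_eq_infsum[OF A] by simp
  qed
  then have "zeta (real (Suc m + 1)) * moment b E (Suc m) d / real b ^ (Suc m + 1) =
      zeta (real (Suc m + 1)) * (\<Sum>\<^sub>\<infinity>X\<in>lists A. ?w X * ?y X ^ Suc m) / real b" for m
    by simp
  moreover have "kempner_tail b A (Suc k * b - d) - mass / real (Suc k * b) =
      (\<Sum>\<^sub>\<infinity>X\<in>lists A. ?w X * (1 / (real (Suc k) - ?y X) - 1 / real (Suc k))) / real b" for k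
  proof -
    let ?n = "Suc k * b - d"
    have "b \<le> Suc k * b" by simp
    then have n: "?n > 0" "real ?n = real (Suc k * b) - real d" using d by (linarith, simp)
    have "((\<lambda>X. 1 / real (?n * b ^ length X + string_val b X) + ?w X * (- (1 / real (Suc k * b)))) has_sum
        kempner_tail b A ?n + mass * (- (1 / real (Suc k * b)))) (lists A)"
      by (intro has_sum_add kempner_tail_has_sum n has_sum_cmult_left weight_has_sum)
    moreover have "1 / real (?n * b ^ length X + string_val b X) + ?w X * (- (1 / real (Suc k * b))) =
        ?w X * (1 / (real (Suc k) - ?y X) - 1 / real (Suc k)) * (1 / real b)" for X
    proof -
      have "real ?n + string_frac b X = (real (Suc k) - ?y X) * real b"
        unfolding n using b_pos by (simp add: field_simps)
      then have eq: "1 / (real ?n + string_frac b X) = 1 / (real (Suc k) - ?y X) * (1 / real b)" by simp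
      have "w * (Q * (1 / c)) + w * (- (1 / (K * c))) = w * (Q - 1 / K) * (1 / c)" for w Q K c :: real
        by (simp add: algebra_simps)
      then show ?thesis unfolding reciprocal_eq_weighted eq of_nat_mult .
    qed
    ultimately have "((\<lambda>X. ?w X * (1 / (real (Suc k) - ?y X) - 1 / real (Suc k)) * (1 / real b)) has_sum
        kempner_tail b A ?n + mass * (- (1 / real (Suc k * b)))) (lists A)" by simp
    from infsumI[OF this] show ?thesis unfolding infsum_cmult_left' by simp
  qed
  ultimately show ?thesis using sums_divide[OF s1, of "real b"] sums_divide[OF s2, of "real b"] by auto
qed

end

text \<open>\<open>infsum\<close> and \<open>suminf\<close> have values even without convergence, so
  convergence of both sums is asserted too. The index \<open>Suc m\<close> starts the zeta series at
  1.\<close>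

theorem theorem6:
  fixes b :: nat and E F :: "nat set"
  assumes "b \<ge> 2" and "E \<subseteq> {..<b}" and "E \<noteq> {}"
    and "F = (\<lambda>a. (b - a) mod b) ` E"
  shows "(\<lambda>m. 1 / real m) summable_on admissible b E \<and>
    summable (\<lambda>m. zeta (real (Suc m + 1)) * (\<Sum>d\<in>F. moment b E (Suc m) d) / real b ^ (Suc m + 1)) \<and>
    kempner_sum b E = real b / real (card E) * ln (real b) -
      (\<Sum>m. zeta (real (Suc m + 1)) * (\<Sum>d\<in>F. moment b E (Suc m) d) / real b ^ (Suc m + 1))"
proof -
  define A where "A = {..<b} - E"
  interpret missing_digits b A
    by unfold_locales (use assms in \<open>auto simp: A_def\<close>)
  let ?U = "kempner_tail b A"
  have finE: "finite E" using assms(2) finite_subset by blast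
  have card_F: "card F = card E"
    unfolding assms(4) by (intro card_image inj_on_subset[OF inj_on_negate_mod assms(2)])
  have card_E: "card E > 0" using finE assms(3) by (simp add: card_gt_0_iff)
  have "card A = b - card E"
    unfolding A_def using assms(2) finE by (simp add: card_Diff_subset)
  moreover have "card E \<le> b" using card_mono[OF _ assms(2)] by simp
  ultimately have mass: "mass = real b / real (card E)"
    by (simp add: mass_def)
  note K = reciprocal_admissible_has_sum[OF assms(1) A_def]
  \<comment> \<open>For each \<open>d\<close> the zeta series and the block series share a limit
    \<open>s d\<close>. Summed over \<open>F\<close>, the first gives the value of the zeta series;
    the second is evaluated independently below.\<close>
  have "\<forall>d\<in>F. \<exists>s. (\<lambda>m. zeta (real (Suc m + 1)) * moment b E (Suc m) d / real b ^ (Suc m + 1)) sums s \<and>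
    (\<lambda>k. ?U (Suc k * b - d) - mass / real (Suc k * b)) sums s"
    using b_pos by (intro ballI zeta_moment_sums_kempner_tail assms A_def) (auto simp: assms(4))
  from bchoice[OF this] obtain s where
    s1: "\<And>d. d \<in> F \<Longrightarrow> (\<lambda>m. zeta (real (Suc m + 1)) * moment b E (Suc m) d / real b ^ (Suc m + 1)) sums s d" and
    s2: "\<And>d. d \<in> F \<Longrightarrow> (\<lambda>k. ?U (Suc k * b - d) - mass / real (Suc k * b)) sums s d"
    by blast
  have S1: "(\<lambda>m. zeta (real (Suc m + 1)) * (\<Sum>d\<in>F. moment b E (Suc m) d) / real b ^ (Suc m + 1)) sums sum s F"
    using sums_sum[of F "\<lambda>d m. zeta (real (Suc m + 1)) * moment b E (Suc m) d / real b ^ (Suc m + 1)" s, OF s1]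
    by (simp add: sum_distrib_left sum_divide_distrib)
  have "(\<Sum>d\<in>F. ?U (Suc k * b - d) - mass / real (Suc k * b)) =
      (\<Sum>d\<in>F. ?U (Suc k * b - d)) - 1 / real (Suc k)" for k
  proof -
    \<comment> \<open>The \<open>card E\<close> subtracted terms add up to exactly one harmonic term
      because \<open>mass\<close> is \<open>b / card E\<close>.\<close>
    have "real (card E) * (mass / real (Suc k * b)) = 1 / real (Suc k)"
      unfolding mass of_nat_mult using card_E b_pos by (simp del: of_nat_Suc)
    then show ?thesis by (simp add: sum_subtractf card_F del: of_nat_Suc of_nat_mult mult_Suc)
  qed
  then have "(\<lambda>k. (\<Sum>d\<in>F. ?U (Suc k * b - d)) - 1 / real (Suc k)) sums sum s F"
    using sums_sum[of F "\<lambda>d k. ?U (Suc k * b - d) - mass / real (Suc k * b)" s, OF s2] by simp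
  then have lim1: "(\<lambda>M. \<Sum>k<M. (\<Sum>d\<in>F. ?U (Suc k * b - d)) - 1 / real (Suc k)) \<longlonglongrightarrow> sum s F"
    by (simp add: sums_def)
  have "(\<lambda>M. ?U (M * b)) \<longlonglongrightarrow> 0"
    using b_pos by (intro filterlim_compose[OF kempner_tail_LIMSEQ_0] filterlim_subseq) (auto simp: strict_mono_def)
  then have "(\<lambda>M. if 0 \<in> E then ?U (M * b) else 0) \<longlonglongrightarrow> 0"
    by (cases "0 \<in> E") auto
  \<comment> \<open>The harmonic sum in \<open>sum_excluded_blocks\<close> stops at
    \<open>M - 1\<close>, while the subtracted one runs to \<open>M\<close>; hence the term
    \<open>- 1 / M\<close>.\<close>
  then have "(\<lambda>M. (\<Sum>n\<in>{M..<M * b}. ?U n) - (\<Sum>a\<in>A - {0}. ?U a) - 1 / real M + (if 0 \<in> E then ?U (M * b) else 0))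
      \<longlonglongrightarrow> mass * ln (real b) - (\<Sum>a\<in>A - {0}. ?U a) - 0 + 0"
    by (intro tendsto_intros sum_reciprocal_like_LIMSEQ b_pos mass_nonneg kempner_tail_bounds lim_1_over_n)
  moreover have "eventually (\<lambda>M. (\<Sum>n\<in>{M..<M * b}. ?U n) - (\<Sum>a\<in>A - {0}. ?U a) - 1 / real M
      + (if 0 \<in> E then ?U (M * b) else 0) = (\<Sum>k<M. (\<Sum>d\<in>F. ?U (Suc k * b - d)) - 1 / real (Suc k))) sequentially"
    using eventually_gt_at_top[of 0]
  proof eventually_elim
    case (elim M)
    have "(\<Sum>k<M. 1 / real (Suc k)) = (\<Sum>n\<in>{1..<Suc M}. 1 / real n)"
      using sum.shift_bounds_Suc_ivl[of "\<lambda>n. 1 / real n" 0 M] by (simp add: atLeast0LessThan)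
    also have "\<dots> = (\<Sum>n\<in>{1..<M}. 1 / real n) + 1 / real M" using elim by simp
    finally show ?case
      unfolding sum_subtractf
      using sum_excluded_blocks[OF assms(2,1), of ?U M] kempner_tail_rec elim
      unfolding A_def[symmetric] assms(4)[symmetric] by simp
  qed
  ultimately have "(\<lambda>M. \<Sum>k<M. (\<Sum>d\<in>F. ?U (Suc k * b - d)) - 1 / real (Suc k))
      \<longlonglongrightarrow> mass * ln (real b) - (\<Sum>a\<in>A - {0}. ?U a) - 0 + 0"
    by (rule Lim_transform_eventually)
  from LIMSEQ_unique[OF lim1 this] have "sum s F = mass * ln (real b) - kempner_sum b E"
    using infsumI[OF K] by (simp add: kempner_sum_def)
  then show ?thesis
    using K S1 by (auto simp: summable_on_def sums_iff mass)
qed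

end
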